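(* Let $(X,\mathscr{B})$ and $(Y,\mathscr{C})$ be measurable spaces such that in each of them singletons are measurable. Then the following are equivalent: (1) There is no free ultrafilter in $\mathscr{B}\times\mathscr{C}$ with the countable intersection property. (2) Neither is there a free ultrafilter in $\mathscr{B}$ with the countable intersection property, nor is there a free ultrafilter in $\mathscr{C}$ with the countable intersection property.
   Context: $\mathscr{B}\times\mathscr{C}$ denotes the smallest $\sigma$-algebra on $X\times Y$ containing all measurable rectangles $B\times C$ with $B\in\mathscr{B}$ and $C\in\mathscr{C}$. For a measurable space $(X,\mathscr{B})$: a non-empty $\mathscr{A}\subseteq\mathscr{B}$ is a filter-base in $\mathscr{B}$ if for every $A,B\in\mathscr{A}$ there is a non-empty $C\in\mathscr{A}$ with $C\subseteq A\cap B$. A filter $\mathscr{F}$ in $\mathscr{B}$ is a filter-base such that $B\in\mathscr{F}$ whenever $B\in\mathscr{B}$ and $F\subseteq B$ for some $F\in\mathscr{F}$. An ultrafilter in $\mathscr{B}$ is a maximal (with respect to $\subseteq$) filter in $\mathscr{B}$. An ultrafilter is free if the intersection of all its elements is empty. It has the countable intersection property if every countable collection of its elements has non-empty intersection.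
   Formalization: X and Y are assumed non-empty; otherwise the claim fails: for X empty and Y uncountable with the countable/co-countable σ-algebra, (1) holds since the product carries no filter, but the co-countable sets violate (2). *)

theory Defs
  imports "HOL-Analysis.Analysis"
begin

(* The empty set is never a member: A = B = {} would require a non-empty subset of {}. *)
definition filter_base_in :: "'a set set \<Rightarrow> 'a set set \<Rightarrow> bool" where
  "filter_base_in \<B> \<A> \<longleftrightarrow>
     \<A> \<noteq> {} \<and> \<A> \<subseteq> \<B> \<and>
     (\<forall>A\<in>\<A>. \<forall>B\<in>\<A>. \<exists>C\<in>\<A>. C \<noteq> {} \<and> C \<subseteq> A \<inter> B)"

definition filter_in :: "'a set set \<Rightarrow> 'a set set \<Rightarrow> bool" where
  "filter_in \<B> \<F> \<longleftrightarrow>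
     filter_base_in \<B> \<F> \<and> (\<forall>B\<in>\<B>. (\<exists>F\<in>\<F>. F \<subseteq> B) \<longrightarrow> B \<in> \<F>)"

definition ultrafilter_in :: "'a set set \<Rightarrow> 'a set set \<Rightarrow> bool" where
  "ultrafilter_in \<B> \<U> \<longleftrightarrow>
     filter_in \<B> \<U> \<and> (\<forall>\<F>. filter_in \<B> \<F> \<and> \<U> \<subseteq> \<F> \<longrightarrow> \<F> = \<U>)"

definition free_family :: "'a set set \<Rightarrow> bool" where
  "free_family \<U> \<longleftrightarrow> \<Inter>\<U> = {}"

(* The empty subfamily imposes no condition, since its intersection is UNIV. *)
definition countable_intersection_property :: "'a set set \<Rightarrow> bool" where
  "countable_intersection_property \<U> \<longleftrightarrow>
     (\<forall>\<D>. \<D> \<subseteq> \<U> \<and> countable \<D> \<longrightarrow> \<Inter>\<D> \<noteq> {})"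

end

theory Submission
  imports Defs
begin

text \<open>
  For a family of measurable sets with the countable intersection property, being an ultrafilter
  amounts to containing each measurable set or its complement. This characterisation is visibly
  preserved under images along measurable maps. Pushing an ultrafilter on the product forward along
  both projections gives two ultrafilters; if neither is free, they contain singletons \<open>{x}\<close> and
  \<open>{y}\<close>, and the given ultrafilter is then the one of all sets through \<open>(x, y)\<close>. Conversely, a free
  ultrafilter on a factor is pushed into the product along the embedding of a slice.
\<close>

lemma filter_inD:
  assumes "filter_in \<B> \<F>"
  shows "\<F> \<noteq> {}" "\<F> \<subseteq> \<B>"
    and "\<And>F B. F \<in> \<F> \<Longrightarrow> F \<subseteq> B \<Longrightarrow> B \<in> \<B> \<Longrightarrow> B \<in> \<F>"
    and "\<And>A B. A \<in> \<F> \<Longrightarrow> B \<in> \<F> \<Longrightarrow> \<exists>C\<in>\<F>. C \<noteq> {} \<and> C \<subseteq> A \<inter> B"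
  using assms unfolding filter_in_def filter_base_in_def by blast+

lemma filter_inI:
  assumes "\<F> \<noteq> {}" "\<F> \<subseteq> \<B>"
    and "\<And>F B. F \<in> \<F> \<Longrightarrow> F \<subseteq> B \<Longrightarrow> B \<in> \<B> \<Longrightarrow> B \<in> \<F>"
    and "\<And>A B. A \<in> \<F> \<Longrightarrow> B \<in> \<F> \<Longrightarrow> \<exists>C\<in>\<F>. C \<noteq> {} \<and> C \<subseteq> A \<inter> B"
  shows "filter_in \<B> \<F>"
  unfolding filter_in_def filter_base_in_def
proof (intro conjI ballI impI)
  fix B assume "B \<in> \<B>" "\<exists>F\<in>\<F>. F \<subseteq> B"
  then show "B \<in> \<F>" using assms(3) by blast
qed (use assms(1,2,4) in simp_all)

lemma ultrafilter_in_imp_filter_in: "ultrafilter_in \<B> \<U> \<Longrightarrow> filter_in \<B> \<U>"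
  unfolding ultrafilter_in_def by (rule conjunct1)

text \<open>If every member meets \<open>B\<close>, adjoining \<open>B\<close> generates a larger
  filter, and maximality puts \<open>B\<close> into \<open>\<U>\<close>; a member disjoint from
  \<open>B\<close> lies in the complement instead.\<close>

lemma ultrafilter_in_sets_compl:
  assumes U: "ultrafilter_in (sets M) \<U>" and B: "B \<in> sets M"
  shows "B \<in> \<U> \<or> space M - B \<in> \<U>"
proof -
  note filt = filter_inD[OF ultrafilter_in_imp_filter_in[OF U]]
  show ?thesis
  proof (cases "\<exists>F\<in>\<U>. F \<inter> B = {}")
    case True
    then obtain F where F: "F \<in> \<U>" "F \<inter> B = {}" by blast
    then have "F \<subseteq> space M - B" using filt(2) sets.sets_into_space by blast
    then have "space M - B \<in> \<U>" using filt(3)[OF F(1)] B by blast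
    then show ?thesis ..
  next
    case False
    \<comment> \<open>The filter generated by the traces of the members on \<open>B\<close>; the
      failed case assumption keeps these traces non-empty.\<close>
    define \<G> where "\<G> = {A \<in> sets M. \<exists>F\<in>\<U>. F \<inter> B \<subseteq> A}"
    have sub: "\<U> \<subseteq> \<G>" using filt(2) unfolding \<G>_def by blast
    have "\<exists>C\<in>\<G>. C \<noteq> {} \<and> C \<subseteq> A \<inter> A'" if AA': "A \<in> \<G>" "A' \<in> \<G>" for A A'
    proof -
      from AA' obtain F F' where F: "F \<in> \<U>" "F' \<in> \<U>" "F \<inter> B \<subseteq> A" "F' \<inter> B \<subseteq> A'"
        unfolding \<G>_def by blast
      obtain C where C: "C \<in> \<U>" "C \<subseteq> F \<inter> F'" using filt(4)[OF F(1,2)] by blast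
      then have "C \<inter> B \<in> sets M" using B filt(2) by blast
      with C have "C \<inter> B \<in> \<G>" unfolding \<G>_def by blast
      moreover have "C \<inter> B \<noteq> {}" using False C(1) by blast
      moreover have "C \<inter> B \<subseteq> A \<inter> A'" using F(3,4) C(2) by blast
      ultimately show ?thesis by (intro bexI[of _ "C \<inter> B"] conjI)
    qed
    moreover have "\<G> \<noteq> {}" using filt(1) sub by blast
    moreover have "\<G> \<subseteq> sets M" unfolding \<G>_def by blast
    moreover have "A \<in> \<G>" if "F \<in> \<G>" "F \<subseteq> A" "A \<in> sets M" for F A
      using that unfolding \<G>_def by blast
    ultimately have "filter_in (sets M) \<G>" by (intro filter_inI)
    with sub U have "\<G> = \<U>" unfolding ultrafilter_in_def by simp
    moreover have "B \<in> \<G>" using B filt(1) unfolding \<G>_def by blast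
    ultimately show ?thesis by blast
  qed
qed

text \<open>Three sets allow testing two members against the complement of their intersection, and
  two cylinders against an arbitrary member.\<close>

lemma countable_intersection_property_inter:
  assumes "countable_intersection_property \<U>" "A \<in> \<U>" "B \<in> \<U>" "C \<in> \<U>"
  shows "A \<inter> B \<inter> C \<noteq> {}"
proof -
  have "{A, B, C} \<subseteq> \<U>" "countable {A, B, C}" using assms by auto
  then have "\<Inter>{A, B, C} \<noteq> {}"
    using assms(1) unfolding countable_intersection_property_def by blast
  then show ?thesis by auto
qed

text \<open>The countable intersection property supplies the non-empty finite intersections that the
  filter axioms demand. The right-hand side no longer quantifies over filters, so it can be
  transported along maps.\<close>

lemma ultrafilter_in_sets_iff:
  assumes cip: "countable_intersection_property \<U>"
  shows "ultrafilter_in (sets M) \<U> \<longleftrightarrow>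
    \<U> \<subseteq> sets M \<and> (\<forall>B\<in>sets M. B \<in> \<U> \<or> space M - B \<in> \<U>)"
proof
  assume "ultrafilter_in (sets M) \<U>"
  then show "\<U> \<subseteq> sets M \<and> (\<forall>B\<in>sets M. B \<in> \<U> \<or> space M - B \<in> \<U>)"
    using ultrafilter_in_sets_compl filter_inD(2)[OF ultrafilter_in_imp_filter_in] by blast
next
  assume "\<U> \<subseteq> sets M \<and> (\<forall>B\<in>sets M. B \<in> \<U> \<or> space M - B \<in> \<U>)"
  then have sub: "\<U> \<subseteq> sets M" and compl: "\<And>B. B \<in> sets M \<Longrightarrow> B \<in> \<U> \<or> space M - B \<in> \<U>"
    by auto
  note inter = countable_intersection_property_inter[OF cip]
  have meet: "A \<inter> B \<noteq> {}" if "A \<in> \<U>" "B \<in> \<U>" for A B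
    using inter[OF that(1) that] by simp
  have "filter_in (sets M) \<U>"
  proof (rule filter_inI)
    show "\<U> \<noteq> {}" using compl[OF sets.top] by blast
    \<comment> \<open>Otherwise the complement of \<open>B\<close> would be a member disjoint from
      \<open>F\<close>.\<close>
    show "B \<in> \<U>" if "F \<in> \<U>" "F \<subseteq> B" "B \<in> sets M" for F B
      using compl[OF that(3)] meet[OF that(1), of "space M - B"] that(2) by blast
    show "\<exists>C\<in>\<U>. C \<noteq> {} \<and> C \<subseteq> A \<inter> B" if "A \<in> \<U>" "B \<in> \<U>" for A B
    proof -
      have "A \<inter> B \<in> sets M" using that sub by auto
      \<comment> \<open>Otherwise the complement of \<open>A \<inter> B\<close> would be a member,
        and it has no point in common with both \<open>A\<close> and \<open>B\<close>.\<close>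
      then have "A \<inter> B \<in> \<U>"
        using compl[of "A \<inter> B"] inter[OF that, of "space M - A \<inter> B"] by blast
      then show ?thesis using meet[OF that] by (intro bexI[of _ "A \<inter> B"]) auto
    qed
  qed (rule sub)
  moreover have "\<F> \<subseteq> \<U>" if "filter_in (sets M) \<F>" "\<U> \<subseteq> \<F>" for \<F>
  proof
    fix A assume A: "A \<in> \<F>"
    note filt = filter_inD[OF that(1)]
    \<comment> \<open>A filter cannot contain two disjoint sets; the dichotomy for
      \<open>\<U>\<close> then leaves only \<open>A \<in> \<U>\<close>.\<close>
    have "space M - A \<notin> \<F>" using filt(4)[OF A, of "space M - A"] by blast
    moreover have "A \<in> sets M" using A filt(2) by blast
    ultimately show "A \<in> \<U>" using compl[of A] that(2) by blast
  qed
  ultimately show "ultrafilter_in (sets M) \<U>" unfolding ultrafilter_in_def by auto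
qed

text \<open>The push-forward of a family of sets, analogous to \<open>distr\<close> for measures;
  preimages are cut down to \<open>space M\<close> because \<open>f\<close> is total on the
  type.\<close>

definition image_family :: "'a measure \<Rightarrow> 'b measure \<Rightarrow> ('a \<Rightarrow> 'b) \<Rightarrow> 'a set set \<Rightarrow> 'b set set" where
  "image_family M N f \<U> = {B \<in> sets N. f -` B \<inter> space M \<in> \<U>}"

text \<open>If \<open>x\<close> is common to the preimages, then \<open>f x\<close> is common to the
  given sets.\<close>

lemma countable_intersection_property_image_family:
  assumes "countable_intersection_property \<U>"
  shows "countable_intersection_property (image_family M N f \<U>)"
  unfolding countable_intersection_property_def
proof (intro allI impI, elim conjE)
  fix \<D> assume D: "\<D> \<subseteq> image_family M N f \<U>" "countable \<D>"
  let ?E = "(\<lambda>B. f -` B \<inter> space M) ` \<D>"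
  have "?E \<subseteq> \<U>" "countable ?E" using D unfolding image_family_def by auto
  then have "\<Inter>?E \<noteq> {}" using assms unfolding countable_intersection_property_def by blast
  then obtain x where "x \<in> \<Inter>?E" by blast
  then have "f x \<in> \<Inter>\<D>" by blast
  then show "\<Inter>\<D> \<noteq> {}" by blast
qed

text \<open>Preimages commute with complements, so the dichotomy passes from \<open>\<U>\<close> to
  its image.\<close>

lemma ultrafilter_in_image_family:
  assumes f: "f \<in> measurable M N" and cip: "countable_intersection_property \<U>"
    and U: "ultrafilter_in (sets M) \<U>"
  shows "ultrafilter_in (sets N) (image_family M N f \<U>)"
proof -
  have "f -` (space N - B) \<inter> space M = space M - (f -` B \<inter> space M)" for B
    using measurable_space[OF f] by auto
  then show ?thesis
    using U measurable_sets[OF f]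
    unfolding ultrafilter_in_sets_iff[OF cip]
      ultrafilter_in_sets_iff[OF countable_intersection_property_image_family[OF cip]]
    by (auto simp: image_family_def)
qed

text \<open>The complement of \<open>{x}\<close> misses \<open>x\<close>, so for a point
  \<open>x\<close> common to all members the dichotomy selects \<open>{x}\<close>.\<close>

lemma not_free_imp_singleton:
  assumes U: "ultrafilter_in (sets M) \<U>" and "\<not> free_family \<U>"
    and singletons: "\<And>x. x \<in> space M \<Longrightarrow> {x} \<in> sets M"
  obtains x where "x \<in> space M" "{x} \<in> \<U>"
proof -
  obtain x where x: "x \<in> \<Inter>\<U>"
    using assms(2) unfolding free_family_def ex_in_conv[symmetric] by blast
  note filt = filter_inD[OF ultrafilter_in_imp_filter_in[OF U]]
  obtain A where A: "A \<in> \<U>" using filt(1) by blast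
  have "A \<subseteq> space M" using A filt(2) sets.sets_into_space by blast
  then have xM: "x \<in> space M" using x A by blast
  moreover have "{x} \<in> \<U>"
    using ultrafilter_in_sets_compl[OF U singletons[OF xM]] x by blast
  ultimately show thesis by (rule that)
qed

text \<open>The left inverse \<open>g\<close> recovers each member \<open>B\<close> as the
  \<open>f\<close>-preimage of its \<open>g\<close>-preimage. Hence a member missing
  \<open>g z\<close> gives a set of the image family missing \<open>z\<close>.\<close>

lemma free_family_image_family:
  assumes free: "free_family \<U>" and U: "\<U> \<subseteq> sets M" and g: "g \<in> measurable N M"
    and gf: "\<And>x. x \<in> space M \<Longrightarrow> f x \<in> space N \<and> g (f x) = x"
  shows "free_family (image_family M N f \<U>)"
proof -
  have "z \<notin> \<Inter>(image_family M N f \<U>)" for z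
  proof -
    obtain B where B: "B \<in> \<U>" "g z \<notin> B" using free unfolding free_family_def by blast
    have BM: "B \<in> sets M" using B(1) U by blast
    have "f -` (g -` B \<inter> space N) \<inter> space M = B"
    proof (intro equalityI subsetI)
      fix x assume "x \<in> f -` (g -` B \<inter> space N) \<inter> space M"
      then show "x \<in> B" using gf[of x] by simp
    next
      fix x assume "x \<in> B"
      moreover from this have "x \<in> space M" using sets.sets_into_space[OF BM] by blast
      ultimately show "x \<in> f -` (g -` B \<inter> space N) \<inter> space M" using gf[of x] by simp
    qed
    then have "g -` B \<inter> space N \<in> image_family M N f \<U>"
      using B(1) measurable_sets[OF g BM] unfolding image_family_def by simp
    then show ?thesis using B by blast
  qed
  then show ?thesis unfolding free_family_def by blast
qed

text \<open>Serves for a slice embedding \<open>f\<close> with a coordinate projection as its left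
  inverse \<open>g\<close>.\<close>

lemma ex_free_ultrafilter_section:
  assumes "\<exists>\<U>. ultrafilter_in (sets M) \<U> \<and> free_family \<U> \<and> countable_intersection_property \<U>"
    and f: "f \<in> measurable M N" and g: "g \<in> measurable N M"
    and gf: "\<And>x. x \<in> space M \<Longrightarrow> g (f x) = x"
  shows "\<exists>\<V>. ultrafilter_in (sets N) \<V> \<and> free_family \<V> \<and> countable_intersection_property \<V>"
proof -
  from assms(1) obtain \<U> where U: "ultrafilter_in (sets M) \<U>" and free: "free_family \<U>"
    and cip: "countable_intersection_property \<U>" by blast
  have "\<U> \<subseteq> sets M" using filter_inD(2)[OF ultrafilter_in_imp_filter_in[OF U]] .
  then have "free_family (image_family M N f \<U>)"
    by (rule free_family_image_family[OF free _ g]) (simp add: gf measurable_space[OF f])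
  then show ?thesis
    using ultrafilter_in_image_family[OF f cip U]
      countable_intersection_property_image_family[OF cip] by blast
qed

theorem theorem4p5:
  fixes M :: "'a measure" and N :: "'b measure"
  assumes "space M \<noteq> {}" and "space N \<noteq> {}"
    and "\<And>x. x \<in> space M \<Longrightarrow> {x} \<in> sets M"
    and "\<And>y. y \<in> space N \<Longrightarrow> {y} \<in> sets N"
  shows "(\<not> (\<exists>\<U>. ultrafilter_in (sets (M \<Otimes>\<^sub>M N)) \<U> \<and> free_family \<U> \<and>
                  countable_intersection_property \<U>))
     \<longleftrightarrow>
         (\<not> (\<exists>\<U>. ultrafilter_in (sets M) \<U> \<and> free_family \<U> \<and>
                  countable_intersection_property \<U>) \<and>
          \<not> (\<exists>\<U>. ultrafilter_in (sets N) \<U> \<and> free_family \<U> \<and>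
                  countable_intersection_property \<U>))"
  (is "\<not> ?P \<longleftrightarrow> \<not> ?A \<and> \<not> ?B")
proof -
  \<comment> \<open>Base points of the slices. With one factor empty the product would be empty, and
    no slice could carry an ultrafilter of the other factor.\<close>
  obtain x0 y0 where x0: "x0 \<in> space M" and y0: "y0 \<in> space N" using assms(1,2) by blast
  have ?P if ?A
    by (rule ex_free_ultrafilter_section[OF that, where f = "\<lambda>x. (x, y0)" and g = fst])
      (use y0 in auto)
  moreover have ?P if ?B
    by (rule ex_free_ultrafilter_section[OF that, where f = "\<lambda>y. (x0, y)" and g = snd])
      (use x0 in auto)
  moreover have "?A \<or> ?B" if ?P
  proof (rule ccontr)
    assume no: "\<not> (?A \<or> ?B)"
    from that obtain \<U> where U: "ultrafilter_in (sets (M \<Otimes>\<^sub>M N)) \<U>" and free: "free_family \<U>"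
      and cip: "countable_intersection_property \<U>" by blast
    let ?F = "image_family (M \<Otimes>\<^sub>M N) M fst \<U>" and ?G = "image_family (M \<Otimes>\<^sub>M N) N snd \<U>"
    note cips = countable_intersection_property_image_family[OF cip]
    have F: "ultrafilter_in (sets M) ?F" and G: "ultrafilter_in (sets N) ?G"
      by (rule ultrafilter_in_image_family[OF _ cip U]; measurable)+
    have "\<not> free_family ?F" "\<not> free_family ?G" using no F G cips by blast+
    obtain x where x: "{x} \<in> ?F"
      by (rule not_free_imp_singleton[OF F \<open>\<not> free_family ?F\<close> assms(3)])
    obtain y where y: "{y} \<in> ?G"
      by (rule not_free_imp_singleton[OF G \<open>\<not> free_family ?G\<close> assms(4)])
    \<comment> \<open>The cylinders over \<open>{x}\<close> and \<open>{y}\<close> belong to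
      \<open>\<U>\<close> and share at most the point \<open>(x, y)\<close>, so meeting
      \<open>A\<close> forces that point into \<open>A\<close>.\<close>
    have "(x, y) \<in> A" if "A \<in> \<U>" for A
    proof -
      have "fst -` {x} \<inter> space (M \<Otimes>\<^sub>M N) \<in> \<U>" "snd -` {y} \<inter> space (M \<Otimes>\<^sub>M N) \<in> \<U>"
        using x y unfolding image_family_def by auto
      from countable_intersection_property_inter[OF cip this that] show ?thesis by auto
    qed
    then show False using free unfolding free_family_def by blast
  qed
  ultimately show ?thesis by blast
qed

end
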